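(* Let $\Gamma$ be a finite simplicial graph with at least one vertex. The automorphism group $\mathrm{Aut}(A_\Gamma)$ of the right-angled Artin group $A_\Gamma$ is centerless if and only if $\Gamma$ is not a clique.
   Context: For a finite simplicial graph $\Gamma$ with vertex set $V(\Gamma)$ and edge set $E(\Gamma)$, the right-angled Artin group is $A_\Gamma=\langle V(\Gamma)\mid vw=wv \text{ whenever } \{v,w\}\in E(\Gamma)\rangle$. A clique is a complete graph. Centerless means that the center is trivial. *)

theory Defs
  imports "HOL-Algebra.Bij" "HOL-Library.Ramsey"
begin

text \<open>A letter \<open>(s, True)\<close> is the generator \<open>s\<close>, a letter \<open>(s, False)\<close> its formal inverse.\<close>

type_synonym 'a word = "('a \<times> bool) list"

definition words :: "'a set \<Rightarrow> 'a word set" where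
  "words S = lists (S \<times> UNIV)"

text \<open>The least congruence on words over \<open>S\<close> that makes \<open>(s, True)\<close> and \<open>(s, False)\<close> mutually
  inverse and identifies the two sides of every relation \<open>u = v\<close>, given as a pair \<open>(u, v) \<in> R\<close>.\<close>

inductive_set word_cong :: "'a set \<Rightarrow> ('a word \<times> 'a word) set \<Rightarrow> ('a word \<times> 'a word) set"
  for S R where
  refl: "w \<in> words S \<Longrightarrow> (w, w) \<in> word_cong S R"
| sym: "(u, v) \<in> word_cong S R \<Longrightarrow> (v, u) \<in> word_cong S R"
| trans: "(u, v) \<in> word_cong S R \<Longrightarrow> (v, w) \<in> word_cong S R \<Longrightarrow> (u, w) \<in> word_cong S R"
| append: "(u, u') \<in> word_cong S R \<Longrightarrow> (v, v') \<in> word_cong S R \<Longrightarrow> (u @ v, u' @ v') \<in> word_cong S R"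
| cancel: "s \<in> S \<Longrightarrow> ([(s, e), (s, \<not> e)], []) \<in> word_cong S R"
| relation: "(u, v) \<in> R \<Longrightarrow> u \<in> words S \<Longrightarrow> v \<in> words S \<Longrightarrow> (u, v) \<in> word_cong S R"

text \<open>The group \<open>\<langle>S | R\<rangle>\<close>.\<close>

definition presented_group :: "'a set \<Rightarrow> ('a word \<times> 'a word) set \<Rightarrow> 'a word set monoid" where
  "presented_group S R =
    \<lparr>carrier = words S // word_cong S R,
     mult = (\<lambda>A B. word_cong S R `` {a @ b | a b. a \<in> A \<and> b \<in> B}),
     one = word_cong S R `` {[]}\<rparr>"

definition raag :: "'a set \<Rightarrow> 'a set set \<Rightarrow> 'a word set monoid" where
  "raag V E = presented_group V
     {([(v, True), (w, True)], [(w, True), (v, True)]) | v w. {v, w} \<in> E}"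

definition is_clique :: "'a set \<Rightarrow> 'a set set \<Rightarrow> bool" where
  "is_clique V E \<longleftrightarrow> (\<forall>v\<in>V. \<forall>w\<in>V. v \<noteq> w \<longrightarrow> {v, w} \<in> E)"

definition group_center :: "('a, 'b) monoid_scheme \<Rightarrow> 'a set" where
  "group_center G = {z \<in> carrier G. \<forall>g \<in> carrier G. z \<otimes>\<^bsub>G\<^esub> g = g \<otimes>\<^bsub>G\<^esub> z}"

definition centerless :: "('a, 'b) monoid_scheme \<Rightarrow> bool" where
  "centerless G \<longleftrightarrow> group_center G = {\<one>\<^bsub>G\<^esub>}"

lemma words_Nil [simp]: "[] \<in> words S"
  and words_append [simp]: "u @ v \<in> words S \<longleftrightarrow> u \<in> words S \<and> v \<in> words S"
  by (auto simp: words_def)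

lemma word_cong_in_words: "(u, v) \<in> word_cong S R \<Longrightarrow> u \<in> words S \<and> v \<in> words S"
  by (induction rule: word_cong.induct) (auto simp: words_def)

lemma equiv_word_cong: "equiv (words S) (word_cong S R)"
proof (rule equivI)
  show "word_cong S R \<subseteq> words S \<times> words S"
    using word_cong_in_words by fast
  show "refl_on (words S) (word_cong S R)"
    using word_cong.refl by (auto simp: refl_on_def)
  show "Relation.sym (word_cong S R)"
    by (auto intro: symI word_cong.sym)
  show "Relation.trans (word_cong S R)"
    by (auto intro: transI word_cong.trans)
qed

lemma presented_group_mult_class:
  assumes "u \<in> words S" "v \<in> words S"
  shows "word_cong S R `` {u} \<otimes>\<^bsub>presented_group S R\<^esub> word_cong S R `` {v} = word_cong S R `` {u @ v}"
    (is "?L = ?R")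
proof
  show "?L \<subseteq> ?R"
    unfolding presented_group_def
    by (auto intro: word_cong.trans[OF word_cong.append])
  have "(u, u) \<in> word_cong S R" "(v, v) \<in> word_cong S R"
    using assms by (auto intro: word_cong.refl)
  then show "?R \<subseteq> ?L"
    unfolding presented_group_def by fastforce
qed

lemma word_cong_inverse:
  "w \<in> words S \<Longrightarrow> (rev (map (\<lambda>(s, e). (s, \<not> e)) w) @ w, []) \<in> word_cong S R"
proof (induction w)
  case Nil
  then show ?case by (simp add: word_cong.refl)
next
  case (Cons x w)
  obtain s e where x: "x = (s, e)" by force
  let ?w' = "rev (map (\<lambda>(s, e). (s, \<not> e)) w)"
  have s: "s \<in> S" and w: "w \<in> words S" and w': "?w' \<in> words S"
    using Cons.prems by (auto simp: x words_def)
  have "([(s, \<not> e), (s, e)] @ w, [] @ w) \<in> word_cong S R"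
    using word_cong.cancel[OF s, of "\<not> e"] word_cong.refl[OF w] by (intro word_cong.append) auto
  then have "(?w' @ [(s, \<not> e), (s, e)] @ w, ?w' @ w) \<in> word_cong S R"
    using word_cong.append[OF word_cong.refl[OF w']] by simp
  then show ?case
    using word_cong.trans Cons.IH[OF w] by (fastforce simp: x)
qed

lemma group_presented_group: "group (presented_group S R)"
proof (rule groupI)
  have carrier: "carrier (presented_group S R) = {word_cong S R `` {w} | w. w \<in> words S}"
    by (auto simp: presented_group_def quotient_def)
  have one: "\<one>\<^bsub>presented_group S R\<^esub> = word_cong S R `` {[]}"
    by (simp add: presented_group_def)
  show "\<one>\<^bsub>presented_group S R\<^esub> \<in> carrier (presented_group S R)"
    using words_Nil by (force simp: carrier one)
  show "x \<otimes>\<^bsub>presented_group S R\<^esub> y \<in> carrier (presented_group S R)"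
    if "x \<in> carrier (presented_group S R)" "y \<in> carrier (presented_group S R)" for x y
    using that unfolding carrier by (auto simp: presented_group_mult_class)
  show "x \<otimes>\<^bsub>presented_group S R\<^esub> y \<otimes>\<^bsub>presented_group S R\<^esub> z
      = x \<otimes>\<^bsub>presented_group S R\<^esub> (y \<otimes>\<^bsub>presented_group S R\<^esub> z)"
    if "x \<in> carrier (presented_group S R)" "y \<in> carrier (presented_group S R)"
      "z \<in> carrier (presented_group S R)" for x y z
    using that unfolding carrier by (auto simp: presented_group_mult_class)
  show "\<one>\<^bsub>presented_group S R\<^esub> \<otimes>\<^bsub>presented_group S R\<^esub> x = x"
    if "x \<in> carrier (presented_group S R)" for x
    using that unfolding carrier one by (auto simp: presented_group_mult_class)
  show "\<exists>y\<in>carrier (presented_group S R). y \<otimes>\<^bsub>presented_group S R\<^esub> x = \<one>\<^bsub>presented_group S R\<^esub>"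
    if x: "x \<in> carrier (presented_group S R)" for x
  proof -
    obtain w where w: "w \<in> words S" "x = word_cong S R `` {w}"
      using x carrier by auto
    let ?w' = "rev (map (\<lambda>(s, e). (s, \<not> e)) w)"
    have w': "?w' \<in> words S"
      using w(1) by (auto simp: words_def)
    have "word_cong S R `` {?w'} \<otimes>\<^bsub>presented_group S R\<^esub> x = \<one>\<^bsub>presented_group S R\<^esub>"
      using equiv_class_eq[OF equiv_word_cong word_cong_inverse[OF w(1)]]
      by (simp add: presented_group_mult_class w w' one)
    then show ?thesis
      using w' carrier by blast
  qed
qed

lemma group_raag: "group (raag V E)"
  unfolding raag_def by (rule group_presented_group)

end

theory Submission
  imports Defs
begin

text \<open>If $\Gamma$ is a clique then the group is free abelian, and inversion is an automorphism that
  commutes with every automorphism; it is not the identity because a generator and its inverse are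
  different (\<open>inv_generator_neq\<close>).

  Conversely let $\varphi$ be central in the automorphism group. As $\varphi$ commutes with all inner
  automorphisms, $v^{-1}\varphi(v)$ lies in the center of the group for every $v$
  (\<open>central_auto_displacement\<close>). Call a vertex a cone vertex if it is adjacent to all the others.
  The essential input is a description of the center: a shortest word for a central
  element contains only cone vertices (\<open>center_support\<close>). Suppose that $v$ is not a cone vertex and
  let $w$ be a shortest word for $v^{-1}\varphi(v)$. Then $v$ does not occur in $w$. For $s \neq v$ the
  automorphism that inverts $s$ and fixes all other generators fixes $v$, hence also
  $v^{-1}\varphi(v)$; so $w$ and the word with all signs of $s$ changed are reduced words for the same
  element, and $s$ does not occur in $w$ either. So $w$ is empty and $\varphi(v) = v$
  (\<open>central_auto_fixes_non_cone\<close>). If $c$ is a cone vertex and $\Gamma$ is not a clique, choose a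
  vertex $u$ that is not a cone vertex. The transvection $u \mapsto uc$ is an automorphism because
  $c$ is central, and commuting with it gives $u\,\varphi(c) = \varphi(uc) = uc$. So $\varphi$ fixes
  all generators.

  Both uses of reduced words rest on a solution of the word problem
  (\<open>reduced_wcong_imp_trace_eq\<close>): two reduced words for the same element differ only by exchanging
  adjacent commuting letters. The proof is van der Waerden's: the letters act on reduced words,
  considered up to such exchanges, by \<open>push\<close>, and the action satisfies the defining relations.\<close>

section \<open>Central automorphisms of a group\<close>

lemma (in group) commute_inv:
  assumes "x \<in> carrier G" "y \<in> carrier G" "x \<otimes> y = y \<otimes> x"
  shows "inv x \<otimes> y = y \<otimes> inv x"
proof -
  have "y = x \<otimes> (y \<otimes> inv x)"
    using assms by (metis inv_solve_right' m_assoc m_closed inv_closed)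
  then show ?thesis using assms by (metis inv_solve_left m_closed inv_closed)
qed

lemma (in group) commute_mult:
  assumes "x \<in> carrier G" "y \<in> carrier G" "z \<in> carrier G"
    and "x \<otimes> y = y \<otimes> x" "x \<otimes> z = z \<otimes> x"
  shows "x \<otimes> (y \<otimes> z) = y \<otimes> z \<otimes> x"
  using assms by (metis m_assoc)

lemma carrier_AutoGroup: "carrier (AutoGroup G) = auto G"
  by (simp add: AutoGroup_def)

lemma mult_AutoGroup:
  "\<phi> \<in> auto G \<Longrightarrow> \<psi> \<in> auto G \<Longrightarrow> \<phi> \<otimes>\<^bsub>AutoGroup G\<^esub> \<psi> = compose (carrier G) \<phi> \<psi>"
  by (simp add: AutoGroup_def BijGroup_def auto_def)

lemma one_AutoGroup: "\<one>\<^bsub>AutoGroup G\<^esub> = (\<lambda>g\<in>carrier G. g)"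
  by (simp add: AutoGroup_def BijGroup_def)

lemma autoI:
  assumes "h \<in> hom G G" "h \<in> extensional (carrier G)" "k \<in> hom G G"
    and "\<And>g. g \<in> carrier G \<Longrightarrow> k (h g) = g" "\<And>g. g \<in> carrier G \<Longrightarrow> h (k g) = g"
  shows "h \<in> auto G"
  using assms unfolding auto_def Bij_def
  by (auto intro!: bij_betwI[where g = k] simp: hom_def)

lemma (in group) autoD:
  assumes "\<phi> \<in> auto G"
  shows "\<phi> \<in> hom G G" "\<phi> ` carrier G = carrier G" "\<phi> \<in> extensional (carrier G)"
    and "\<And>g. g \<in> carrier G \<Longrightarrow> \<phi> g \<in> carrier G"
    and "\<And>g h. g \<in> carrier G \<Longrightarrow> h \<in> carrier G \<Longrightarrow> \<phi> (g \<otimes> h) = \<phi> g \<otimes> \<phi> h"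
    and "\<And>g. g \<in> carrier G \<Longrightarrow> \<phi> (inv g) = inv (\<phi> g)"
  using assms group_hom.hom_inv[of G G \<phi>] is_group
  by (auto simp: auto_def Bij_def bij_betw_def hom_def group_hom_def group_hom_axioms_def)

lemma center_AutoGroupD:
  assumes "\<phi> \<in> group_center (AutoGroup G)" "\<psi> \<in> auto G" "g \<in> carrier G"
  shows "\<phi> (\<psi> g) = \<psi> (\<phi> g)"
proof -
  have "\<phi> \<in> auto G" and "compose (carrier G) \<phi> \<psi> = compose (carrier G) \<psi> \<phi>"
    using assms by (auto simp: group_center_def carrier_AutoGroup mult_AutoGroup)
  from fun_cong[OF this(2), of g] show ?thesis using assms(3) by (simp add: compose_eq)
qed

lemma (in group) inv_mult_cancel:
  assumes "b \<in> carrier G" "g \<in> carrier G"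
  shows "inv b \<otimes> (b \<otimes> g) = g" "b \<otimes> (inv b \<otimes> g) = g"
  using assms by (simp_all add: m_assoc[symmetric])

lemma (in group) conjugation_auto:
  assumes a: "a \<in> carrier G"
  shows "(\<lambda>g\<in>carrier G. a \<otimes> g \<otimes> inv a) \<in> auto G"
proof -
  have hom: "(\<lambda>g\<in>carrier G. b \<otimes> g \<otimes> inv b) \<in> hom G G" if b: "b \<in> carrier G" for b
    by (rule homI) (use b in \<open>auto simp: m_assoc inv_mult_cancel\<close>)
  show ?thesis
    using a hom[OF a] hom[of "inv a"]
    by (intro autoI[where k = "\<lambda>g\<in>carrier G. inv a \<otimes> g \<otimes> inv (inv a)"])
      (auto simp: m_assoc inv_mult_cancel)
qed

text \<open>Comparing \<open>\<phi> (a g a\<^sup>-\<^sup>1)\<close> with \<open>a \<phi>(g) a\<^sup>-\<^sup>1\<close> shows that \<open>a\<close> and \<open>\<phi> a\<close> induce the same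
  conjugation on the image of \<open>\<phi>\<close>, which is the whole group.\<close>
lemma (in group) central_auto_displacement:
  assumes \<phi>: "\<phi> \<in> group_center (AutoGroup G)" and a: "a \<in> carrier G"
  shows "inv a \<otimes> \<phi> a \<in> group_center G"
proof -
  have auto: "\<phi> \<in> auto G" using \<phi> by (auto simp: group_center_def carrier_AutoGroup)
  note [simp] = autoD(4-6)[OF auto]
  let ?z = "inv a \<otimes> \<phi> a"
  have "?z \<otimes> h = h \<otimes> ?z" if h: "h \<in> carrier G" for h
  proof -
    obtain g where g: "g \<in> carrier G" "h = \<phi> g" using h autoD(2)[OF auto] by blast
    have "\<phi> (a \<otimes> g \<otimes> inv a) = a \<otimes> \<phi> g \<otimes> inv a"
      using center_AutoGroupD[OF \<phi> conjugation_auto[OF a] g(1)] a g by simp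
    then have "\<phi> a \<otimes> h \<otimes> inv (\<phi> a) = a \<otimes> h \<otimes> inv a"
      using a g by simp
    then have "\<phi> a \<otimes> h = a \<otimes> h \<otimes> inv a \<otimes> \<phi> a"
      using a h by (metis autoD(4)[OF auto] inv_closed inv_solve_right' m_closed)
    then have "inv a \<otimes> (\<phi> a \<otimes> h) = inv a \<otimes> (a \<otimes> (h \<otimes> (inv a \<otimes> \<phi> a)))"
      using a h by (simp add: m_assoc)
    also have "\<dots> = h \<otimes> ?z" using a h by (simp add: m_assoc[symmetric])
    finally show ?thesis using a h by (simp add: m_assoc)
  qed
  then show ?thesis using a by (simp add: group_center_def)
qed

lemma (in comm_group) AutoGroup_not_centerless:
  assumes g: "g \<in> carrier G" "inv g \<noteq> g"
  shows "\<not> centerless (AutoGroup G)"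
proof -
  let ?\<iota> = "\<lambda>g\<in>carrier G. inv g"
  have hom: "?\<iota> \<in> hom G G" by (rule homI) (auto simp: inv_mult)
  have auto: "?\<iota> \<in> auto G" by (rule autoI[OF hom _ hom]) auto
  have "compose (carrier G) ?\<iota> \<psi> = compose (carrier G) \<psi> ?\<iota>" if "\<psi> \<in> auto G" for \<psi>
    using autoD(4,6)[OF that] by (auto simp: compose_def fun_eq_iff)
  then have "?\<iota> \<in> group_center (AutoGroup G)"
    using auto by (auto simp: group_center_def carrier_AutoGroup mult_AutoGroup)
  moreover have "?\<iota> \<noteq> \<one>\<^bsub>AutoGroup G\<^esub>"
  proof
    assume "?\<iota> = \<one>\<^bsub>AutoGroup G\<^esub>"
    from fun_cong[OF this, of g] show False using g by (simp add: one_AutoGroup)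
  qed
  ultimately show ?thesis by (auto simp: centerless_def)
qed

section \<open>Homomorphisms out of a presented group\<close>

definition word_eval :: "('b, 'c) monoid_scheme \<Rightarrow> ('a \<Rightarrow> 'b) \<Rightarrow> 'a word \<Rightarrow> 'b" where
  "word_eval G f w =
    foldr (\<lambda>(s, e) g. (if e then f s else inv\<^bsub>G\<^esub> f s) \<otimes>\<^bsub>G\<^esub> g) w \<one>\<^bsub>G\<^esub>"

lemma carrier_presented_group: "carrier (presented_group S R) = {word_cong S R `` {w} | w. w \<in> words S}"
  by (auto simp: presented_group_def quotient_def)

lemma class_eq_iff:
  "u \<in> words S \<Longrightarrow> v \<in> words S \<Longrightarrow>
    word_cong S R `` {u} = word_cong S R `` {v} \<longleftrightarrow> (u, v) \<in> word_cong S R"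
  by (rule eq_equiv_class_iff[OF equiv_word_cong])

lemma words_Cons [simp]: "x # w \<in> words S \<longleftrightarrow> fst x \<in> S \<and> w \<in> words S"
  by (cases x) (auto simp: words_def)

context group
begin

lemma word_eval_simps [simp]:
  "word_eval G f [] = \<one>"
  "word_eval G f ((s, e) # w) = (if e then f s else inv (f s)) \<otimes> word_eval G f w"
  by (simp_all add: word_eval_def)

lemma word_eval_closed:
  "f \<in> S \<rightarrow> carrier G \<Longrightarrow> w \<in> words S \<Longrightarrow> word_eval G f w \<in> carrier G"
  by (induction w) (auto simp: Pi_iff)

lemma word_eval_append:
  "f \<in> S \<rightarrow> carrier G \<Longrightarrow> u \<in> words S \<Longrightarrow> v \<in> words S \<Longrightarrow>
    word_eval G f (u @ v) = word_eval G f u \<otimes> word_eval G f v"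
proof (induction u)
  case (Cons x u)
  then show ?case using word_eval_closed[OF Cons.prems(1)]
    by (cases x) (auto simp: Pi_iff m_assoc)
qed (simp add: word_eval_closed)

text \<open>The universal property of a presentation (von Dyck).\<close>
lemma presented_group_lift:
  assumes f: "f \<in> S \<rightarrow> carrier G"
    and R: "\<And>u v. (u, v) \<in> R \<Longrightarrow> u \<in> words S \<Longrightarrow> v \<in> words S \<Longrightarrow> word_eval G f u = word_eval G f v"
  obtains h where "h \<in> hom (presented_group S R) G" "h \<in> extensional (carrier (presented_group S R))"
    "\<And>w. w \<in> words S \<Longrightarrow> h (word_cong S R `` {w}) = word_eval G f w"
proof -
  have cong: "word_eval G f u = word_eval G f v" if "(u, v) \<in> word_cong S R" for u v
    using that
  proof induction
    case (append u u' v v')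
    then show ?case
      using word_cong_in_words[of u u'] word_cong_in_words[of v v'] by (simp add: word_eval_append[OF f])
  next
    case (cancel s e)
    then show ?case using f by (auto simp: Pi_iff)
  qed (use R in auto)
  define h where "h = (\<lambda>X\<in>carrier (presented_group S R). word_eval G f (SOME w. w \<in> X))"
  have h: "h (word_cong S R `` {w}) = word_eval G f w" if w: "w \<in> words S" for w
  proof -
    have "(SOME u. u \<in> word_cong S R `` {w}) \<in> word_cong S R `` {w}"
      by (rule someI[of _ w]) (use w word_cong.refl in auto)
    then show ?thesis using w cong by (auto simp: h_def carrier_presented_group)
  qed
  have hom: "h \<in> hom (presented_group S R) G"
    by (rule homI)
      (auto simp: carrier_presented_group presented_group_mult_class h
        word_eval_closed[OF f] word_eval_append[OF f])
  have ext: "h \<in> extensional (carrier (presented_group S R))" by (simp add: h_def)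
  show thesis by (rule that[OF hom ext h])
qed

end

lemma inv_class_letter:
  assumes "s \<in> S"
  shows "inv\<^bsub>presented_group S R\<^esub> (word_cong S R `` {[(s, e)]}) = word_cong S R `` {[(s, \<not> e)]}"
proof (rule group.inv_equality[OF group_presented_group])
  have "([(s, \<not> e), (s, e)], []) \<in> word_cong S R"
    using word_cong.cancel[OF assms, of "\<not> e"] by simp
  then show "word_cong S R `` {[(s, \<not> e)]} \<otimes>\<^bsub>presented_group S R\<^esub> word_cong S R `` {[(s, e)]}
      = \<one>\<^bsub>presented_group S R\<^esub>"
    using assms class_eq_iff[of "[(s, \<not> e), (s, e)]" S "[]" R]
    by (simp add: presented_group_mult_class) (simp add: presented_group_def)
qed (use assms in \<open>auto simp: carrier_presented_group intro!: exI[of _ "[_]"]\<close>)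

lemma hom_presented_group_eqI:
  assumes G: "group G" and h: "h \<in> hom (presented_group S R) G" and k: "k \<in> hom (presented_group S R) G"
    and gens: "\<And>s. s \<in> S \<Longrightarrow> h (word_cong S R `` {[(s, True)]}) = k (word_cong S R `` {[(s, True)]})"
    and g: "g \<in> carrier (presented_group S R)"
  shows "h g = k g"
proof -
  interpret h: group_hom "presented_group S R" G h
    using G h group_presented_group by (simp add: group_hom_def group_hom_axioms_def)
  interpret k: group_hom "presented_group S R" G k
    using G k group_presented_group by (simp add: group_hom_def group_hom_axioms_def)
  have cls: "word_cong S R `` {w} \<in> carrier (presented_group S R)" if "w \<in> words S" for w
    using that by (auto simp: carrier_presented_group)
  have letter: "h (word_cong S R `` {[(s, e)]}) = k (word_cong S R `` {[(s, e)]})" if "s \<in> S" for s e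
  proof (cases e)
    case False
    have "word_cong S R `` {[(s, e)]} = inv\<^bsub>presented_group S R\<^esub> (word_cong S R `` {[(s, True)]})"
      using False inv_class_letter[OF that] by simp
    then show ?thesis using that gens cls[of "[(s, True)]"] by simp
  qed (use gens that in simp)
  have "h (word_cong S R `` {w}) = k (word_cong S R `` {w})" if "w \<in> words S" for w
    using that
  proof (induction w)
    case Nil
    have "word_cong S R `` {[]} = \<one>\<^bsub>presented_group S R\<^esub>" by (simp add: presented_group_def)
    then show ?case by (metis h.hom_one k.hom_one)
  next
    case (Cons x w)
    then have "word_cong S R `` {x # w}
        = word_cong S R `` {[x]} \<otimes>\<^bsub>presented_group S R\<^esub> word_cong S R `` {w}"
      by (simp add: presented_group_mult_class)
    then show ?case using Cons letter[of "fst x" "snd x"] cls[of w] cls[of "[x]"] by simp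
  qed
  then show ?thesis using g by (auto simp: carrier_presented_group)
qed

section \<open>Words up to exchanging commuting letters\<close>

definition inv_letter :: "'a \<times> bool \<Rightarrow> 'a \<times> bool" where
  "inv_letter x = (fst x, \<not> snd x)"

lemma fst_inv_letter [simp]: "fst (inv_letter x) = fst x"
  and inv_letter_inv_letter [simp]: "inv_letter (inv_letter x) = x"
  and inv_letter_neq [simp]: "inv_letter x \<noteq> x" "x \<noteq> inv_letter x"
  by (auto simp: inv_letter_def prod_eq_iff)

locale raag_graph =
  fixes V :: "'a set" and E :: "'a set set"
  assumes edges: "E \<subseteq> [V]\<^bsup>2\<^esup>"
begin

lemma no_loop [simp]: "{s} \<notin> E"
  using edges by (auto simp: nsets_def)

lemma edge_in_V: "{s, t} \<in> E \<Longrightarrow> s \<in> V \<and> t \<in> V"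
  using edges by (auto simp: nsets_def)

text \<open>The equivalence generated by exchanging adjacent letters with adjacent generators, described by
  the projections to pairs of non-adjacent generators, where \<open>s = t\<close> is allowed. With this
  description the relation is an equivalence by its form, and it is preserved by any operation
  that commutes with \<open>filter\<close>; the connection to exchanges is \<open>trace_eq_Cons_split\<close>.\<close>
definition trace_eq :: "'a word \<Rightarrow> 'a word \<Rightarrow> bool" (infix "\<sim>" 50) where
  "u \<sim> v \<longleftrightarrow> (\<forall>s t. {s, t} \<notin> E \<longrightarrow>
     filter (\<lambda>x. fst x \<in> {s, t}) u = filter (\<lambda>x. fst x \<in> {s, t}) v)"

lemma trace_eqD: "u \<sim> v \<Longrightarrow> {s, t} \<notin> E \<Longrightarrow>
    filter (\<lambda>x. fst x \<in> {s, t}) u = filter (\<lambda>x. fst x \<in> {s, t}) v"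
  by (auto simp: trace_eq_def)

lemma trace_eq_refl [simp]: "u \<sim> u"
  and trace_eq_sym: "u \<sim> v \<Longrightarrow> v \<sim> u"
  and trace_eq_trans [trans]: "u \<sim> v \<Longrightarrow> v \<sim> w \<Longrightarrow> u \<sim> w"
  by (simp_all add: trace_eq_def)

lemma trace_eq_Cons: "u \<sim> v \<Longrightarrow> x # u \<sim> x # v"
  by (simp add: trace_eq_def)

lemma trace_eq_remove1: "u \<sim> v \<Longrightarrow> remove1 x u \<sim> remove1 x v"
  by (simp add: trace_eq_def filter_remove1)

lemma trace_eq_filter:
  assumes "u \<sim> v" shows "filter P u \<sim> filter P v"
proof -
  have swap: "filter Q (filter P w) = filter P (filter Q w)" for Q :: "'a \<times> bool \<Rightarrow> bool" and w
    by (simp add: conj_commute)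
  show ?thesis
    unfolding trace_eq_def swap using trace_eqD[OF assms] by (intro allI impI arg_cong[where f = "filter P"])
qed

lemma trace_eq_map:
  assumes "u \<sim> v" and "\<And>x. fst (f x) = fst x"
  shows "map f u \<sim> map f v"
  using assms unfolding trace_eq_def by (simp add: filter_map o_def)

lemma trace_eq_set:
  assumes "u \<sim> v" shows "set u = set v"
proof -
  have "x \<in> set u \<longleftrightarrow> x \<in> set v" for x
    using arg_cong[OF trace_eqD[OF assms, of "fst x" "fst x"], of "\<lambda>l. x \<in> set l"] by simp
  then show ?thesis by blast
qed

lemma filter_commuting_eq_Nil:
  assumes "\<And>c. c \<in> set a \<Longrightarrow> {fst c, fst x} \<in> E" and "{s, t} \<notin> E" and "fst x \<in> {s, t}"
  shows "filter (\<lambda>c. fst c \<in> {s, t}) a = []"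
proof -
  have False if "c \<in> set a" "fst c \<in> {s, t}" for c
    using assms(1)[OF that(1)] assms(2,3) that(2) by (auto simp: insert_commute)
  then show ?thesis by (auto simp: filter_empty_conv)
qed

lemma trace_eq_swap:
  assumes "\<And>c. c \<in> set a \<Longrightarrow> {fst c, fst x} \<in> E"
  shows "a @ x # b \<sim> x # a @ b"
  unfolding trace_eq_def
  using filter_commuting_eq_Nil[OF assms] by auto

text \<open>Before the first occurrence of \<open>x\<close> in \<open>u\<close> there is no letter \<open>c\<close> that fails to commute with \<open>x\<close>:
  in the projection to their generators \<open>x\<close> comes first.\<close>
lemma trace_eq_Cons_split:
  assumes eq: "x # w \<sim> u"
  obtains a b where "u = a @ x # b" "\<And>c. c \<in> set a \<Longrightarrow> {fst c, fst x} \<in> E" "w \<sim> a @ b"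
proof -
  have "x \<in> set u" using trace_eq_set[OF eq] by auto
  then obtain a b where u: "u = a @ x # b" and x: "x \<notin> set a"
    by (meson split_list_first)
  have comm: "{fst c, fst x} \<in> E" if "c \<in> set a" for c
  proof (rule ccontr)
    assume "{fst c, fst x} \<notin> E"
    from trace_eqD[OF eq this]
    have *: "x # filter (\<lambda>y. fst y \<in> {fst c, fst x}) w
        = filter (\<lambda>y. fst y \<in> {fst c, fst x}) a @ x # filter (\<lambda>y. fst y \<in> {fst c, fst x}) b"
      by (simp add: u)
    have "filter (\<lambda>y. fst y \<in> {fst c, fst x}) a \<noteq> []"
      using that by (auto simp: filter_empty_conv)
    then have "x \<in> set (filter (\<lambda>y. fst y \<in> {fst c, fst x}) a)"
      using * by (cases "filter (\<lambda>y. fst y \<in> {fst c, fst x}) a") auto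
    with x show False by simp
  qed
  have "x # w \<sim> x # a @ b"
    using eq trace_eq_swap[OF comm, of a b] unfolding u by (rule trace_eq_trans)
  then have "w \<sim> a @ b"
    using trace_eq_remove1[of _ _ x] by fastforce
  with u comm show thesis by (rule that)
qed

section \<open>Reduced words and the word problem\<close>

definition starts :: "'a \<times> bool \<Rightarrow> 'a word \<Rightarrow> bool" where
  "starts x w \<longleftrightarrow> (\<exists>u. w \<sim> x # u)"

lemma starts_cong: "u \<sim> v \<Longrightarrow> starts x u \<longleftrightarrow> starts x v"
  unfolding starts_def using trace_eq_sym trace_eq_trans by blast

lemma starts_remove1:
  assumes "starts x w" shows "w \<sim> x # remove1 x w"
proof -
  obtain u where u: "w \<sim> x # u" using assms by (auto simp: starts_def)
  then have "remove1 x w \<sim> u" using trace_eq_remove1[OF u, of x] by simp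
  then show ?thesis using u trace_eq_Cons trace_eq_sym trace_eq_trans by blast
qed

lemma starts_Cons_commuting:
  assumes "{fst x, fst y} \<in> E"
  shows "starts x (y # w) \<longleftrightarrow> starts x w"
proof
  assume "starts x (y # w)"
  then obtain u where "x # u \<sim> y # w" using trace_eq_sym by (auto simp: starts_def)
  then obtain a b where ab: "y # w = a @ x # b" "\<And>c. c \<in> set a \<Longrightarrow> {fst c, fst x} \<in> E"
    by (rule trace_eq_Cons_split) blast
  have "x \<noteq> y" using assms by auto
  then obtain a' where a': "a = y # a'" using ab(1) by (cases a) auto
  then have "w \<sim> x # a' @ b" using ab trace_eq_swap[of a' x b] by auto
  then show "starts x w" by (auto simp: starts_def)
next
  assume "starts x w"
  then have "y # w \<sim> [y] @ x # remove1 x w" using starts_remove1 trace_eq_Cons by simp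
  also have "\<dots> \<sim> x # [y] @ remove1 x w"
    using assms by (intro trace_eq_swap) (simp add: insert_commute)
  finally show "starts x (y # w)" by (auto simp: starts_def)
qed

text \<open>Quantifying over all equivalent words, instead of forbidding cancelling pairs in \<open>w\<close> that are
  separated by commuting letters, makes invariance under \<open>\<sim>\<close> immediate.\<close>
definition reduced :: "'a word \<Rightarrow> bool" where
  "reduced w \<longleftrightarrow> (\<nexists>a x b. w \<sim> a @ [x, inv_letter x] @ b)"

lemma reduced_Nil [simp]: "reduced []"
  using trace_eq_set by (fastforce simp: reduced_def)

lemma reduced_cong: "u \<sim> v \<Longrightarrow> reduced u \<longleftrightarrow> reduced v"
  unfolding reduced_def using trace_eq_sym trace_eq_trans by blast

lemma reduced_ConsD:
  assumes "reduced (x # w)" shows "reduced w" "\<not> starts (inv_letter x) w"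
proof -
  have "x # w \<sim> (x # a) @ [y, inv_letter y] @ b" if "w \<sim> a @ [y, inv_letter y] @ b" for a y b
    using trace_eq_Cons[OF that] by simp
  then show "reduced w" using assms unfolding reduced_def by blast
  have "x # w \<sim> [] @ [x, inv_letter x] @ u" if "w \<sim> inv_letter x # u" for u
    using trace_eq_Cons[OF that] by simp
  then show "\<not> starts (inv_letter x) w" using assms unfolding reduced_def starts_def by blast
qed

text \<open>If a cancelling pair appears in a rearrangement of \<open>x # w\<close>, delete \<open>x\<close> from it. Either the pair
  survives in a rearrangement of \<open>w\<close>, or \<open>x\<close> was its first half and the other half can be moved
  to the front of \<open>w\<close>.\<close>
lemma reduced_Cons:
  assumes w: "reduced w" and x: "\<not> starts (inv_letter x) w"
  shows "reduced (x # w)"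
  unfolding reduced_def
proof
  assume "\<exists>a y b. x # w \<sim> a @ [y, inv_letter y] @ b"
  then obtain a y b where "x # w \<sim> a @ [y, inv_letter y] @ b" by blast
  then obtain p q where pq: "a @ [y, inv_letter y] @ b = p @ x # q"
    and comm: "\<And>c. c \<in> set p \<Longrightarrow> {fst c, fst x} \<in> E" and wpq: "w \<sim> p @ q"
    by (rule trace_eq_Cons_split) blast
  from pq consider
      (left) r where "a = p @ x # r" "q = r @ [y, inv_letter y] @ b"
    | (here) "p = a" "x = y" "q = inv_letter y # b"
    | (inv) "p = a @ [y]" "x = inv_letter y"
    | (right) r where "p = a @ [y, inv_letter y] @ r" "b = r @ x # q"
    by (auto simp: append_eq_append_conv2 Cons_eq_append_conv append_eq_Cons_conv)
  then show False
  proof cases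
    case left
    then have "w \<sim> (p @ r) @ [y, inv_letter y] @ b" using wpq by simp
    then show False using w unfolding reduced_def by blast
  next
    case here
    have "p @ q \<sim> inv_letter x # p @ b"
      unfolding here(2,3) using comm here(2) by (intro trace_eq_swap) simp
    then show False using wpq x trace_eq_trans unfolding starts_def by blast
  next
    case inv
    then show False using comm[of y] by simp
  next
    case right
    then have "w \<sim> a @ [y, inv_letter y] @ (r @ q)" using wpq by simp
    then show False using w unfolding reduced_def by blast
  qed
qed

text \<open>Left multiplication by the letter \<open>x\<close> on reduced words up to \<open>\<sim>\<close>.\<close>
definition push :: "'a \<times> bool \<Rightarrow> 'a word \<Rightarrow> 'a word" where
  "push x w = (if starts (inv_letter x) w then remove1 (inv_letter x) w else x # w)"

lemma push_cong: "u \<sim> v \<Longrightarrow> push x u \<sim> push x v"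
  unfolding push_def using starts_cong[of u v] trace_eq_remove1 trace_eq_Cons by simp

lemma reduced_push:
  assumes "reduced w" shows "reduced (push x w)"
proof (cases "starts (inv_letter x) w")
  case True
  have "reduced (inv_letter x # remove1 (inv_letter x) w)"
    using assms reduced_cong[OF starts_remove1[OF True]] by simp
  then show ?thesis using True reduced_ConsD(1) by (auto simp: push_def)
next
  case False
  then show ?thesis using reduced_Cons[OF assms] by (simp add: push_def)
qed

text \<open>Reducedness of \<open>w\<close> ensures that deleting an initial \<open>x\<close> does not expose its inverse, which the
  second \<open>push\<close> would cancel instead of restoring \<open>x\<close>.\<close>
lemma push_push_inv:
  assumes "reduced w" shows "push x (push (inv_letter x) w) \<sim> w"
proof (cases "starts x w")
  case True
  let ?u = "remove1 x w"
  have eq: "w \<sim> x # ?u" using True by (rule starts_remove1)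
  then have "reduced (x # ?u)" using assms reduced_cong by blast
  then have "\<not> starts (inv_letter x) ?u" by (rule reduced_ConsD)
  then show ?thesis using True trace_eq_sym[OF eq] by (simp add: push_def)
next
  case False
  have "starts (inv_letter x) (inv_letter x # w)"
    unfolding starts_def by (blast intro: trace_eq_refl)
  then show ?thesis using False by (simp add: push_def)
qed

text \<open>As \<open>x\<close> and \<open>y\<close> commute, pushing \<open>y\<close> does not change whether the inverse of \<open>x\<close> can be moved to the front, so the two
  operations do not interfere.\<close>
lemma push_commute:
  assumes xy: "{fst x, fst y} \<in> E"
  shows "push x (push y w) \<sim> push y (push x w)"
proof -
  have starts_push: "starts (inv_letter a) (push b w) \<longleftrightarrow> starts (inv_letter a) w"
    if "{fst a, fst b} \<in> E" for a b
  proof (cases "starts (inv_letter b) w")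
    case True
    then show ?thesis
      using starts_cong[OF starts_remove1[OF True]] that
        starts_Cons_commuting[of "inv_letter a" "inv_letter b"]
      by (simp add: push_def)
  next
    case False
    then show ?thesis using that starts_Cons_commuting[of "inv_letter a" b]
      by (simp add: push_def)
  qed
  have yx: "{fst y, fst x} \<in> E" using xy by (simp add: insert_commute)
  have ne: "x \<noteq> inv_letter y" "y \<noteq> inv_letter x" using xy by auto
  have "[x] @ y # w \<sim> y # [x] @ w" using xy by (intro trace_eq_swap) simp
  then show ?thesis
    unfolding push_def[of x "push y w"] push_def[of y "push x w"]
      starts_push[OF xy] starts_push[OF yx]
    using ne remove1_commute[of "inv_letter x" "inv_letter y" w] by (auto simp: push_def)
qed

lemma foldr_push_cong: "u \<sim> v \<Longrightarrow> foldr push w u \<sim> foldr push w v"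
  by (induction w) (auto intro: push_cong)

lemma reduced_foldr_push: "reduced u \<Longrightarrow> reduced (foldr push w u)"
  by (induction w) (auto intro: reduced_push)

lemma foldr_push_reduced: "reduced w \<Longrightarrow> foldr push w [] = w"
proof (induction w)
  case (Cons x w)
  then show ?case using reduced_ConsD[OF Cons.prems] by (simp add: push_def)
qed simp

abbreviation rels :: "('a word \<times> 'a word) set" where
  "rels \<equiv> {([(v, True), (w, True)], [(w, True), (v, True)]) | v w. {v, w} \<in> E}"

abbreviation wcong :: "'a word \<Rightarrow> 'a word \<Rightarrow> bool" (infix "\<doteq>" 50) where
  "u \<doteq> v \<equiv> (u, v) \<in> word_cong V rels"

lemma wcong_foldr_push:
  "u \<doteq> v \<Longrightarrow> reduced w \<Longrightarrow> foldr push u w \<sim> foldr push v w"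
proof (induction arbitrary: w rule: word_cong.induct)
  case (sym u v)
  then show ?case using trace_eq_sym by blast
next
  case (trans u v w)
  then show ?case using trace_eq_trans by blast
next
  case (append u u' v v')
  have "foldr push u (foldr push v w) \<sim> foldr push u' (foldr push v w)"
    using append reduced_foldr_push by blast
  also have "\<dots> \<sim> foldr push u' (foldr push v' w)"
    using append foldr_push_cong by blast
  finally show ?case by simp
next
  case (cancel s e)
  then show ?case using push_push_inv[of w "(s, e)"] by (simp add: inv_letter_def)
next
  case (relation u v)
  then show ?case using push_commute[of "(_, True)" "(_, True)"] by fastforce
qed simp

text \<open>Both words act on the empty word, and a reduced word acts on it by building itself.\<close>
theorem reduced_wcong_imp_trace_eq:
  assumes "reduced u" "reduced v" "u \<doteq> v"
  shows "u \<sim> v"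
  using wcong_foldr_push[OF assms(3) reduced_Nil] assms(1,2) by (simp add: foldr_push_reduced)

section \<open>Words and elements of the group\<close>

abbreviation cls :: "'a word \<Rightarrow> 'a word set" where
  "cls w \<equiv> word_cong V rels `` {w}"

sublocale A: group "raag V E"
  by (rule group_raag)

lemma cls_mult: "u \<in> words V \<Longrightarrow> v \<in> words V \<Longrightarrow> cls u \<otimes>\<^bsub>raag V E\<^esub> cls v = cls (u @ v)"
  unfolding raag_def by (rule presented_group_mult_class)

lemma cls_eq_iff: "u \<in> words V \<Longrightarrow> v \<in> words V \<Longrightarrow> cls u = cls v \<longleftrightarrow> u \<doteq> v"
  by (rule class_eq_iff)

lemma carrier_raag: "carrier (raag V E) = {cls w | w. w \<in> words V}"
  unfolding raag_def by (rule carrier_presented_group)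

lemma cls_closed [simp]: "w \<in> words V \<Longrightarrow> cls w \<in> carrier (raag V E)"
  by (auto simp: carrier_raag)

lemma cls_Nil: "cls [] = \<one>\<^bsub>raag V E\<^esub>"
  by (simp add: raag_def presented_group_def)

lemma inv_cls_letter: "s \<in> V \<Longrightarrow> inv\<^bsub>raag V E\<^esub> cls [(s, e)] = cls [(s, \<not> e)]"
  unfolding raag_def by (rule inv_class_letter)

lemma cls_letter_commute:
  assumes "{s, t} \<in> E"
  shows "cls [(s, e)] \<otimes>\<^bsub>raag V E\<^esub> cls [(t, f)] = cls [(t, f)] \<otimes>\<^bsub>raag V E\<^esub> cls [(s, e)]"
proof -
  let ?comm = "\<lambda>g h. g \<otimes>\<^bsub>raag V E\<^esub> h = h \<otimes>\<^bsub>raag V E\<^esub> g"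
  have st [simp]: "s \<in> V" "t \<in> V" using edge_in_V[OF assms] by auto
  have "[(s, True), (t, True)] \<doteq> [(t, True), (s, True)]"
    using assms by (intro word_cong.relation) auto
  then have "?comm (cls [(s, True)]) (cls [(t, True)])"
    by (simp add: cls_mult cls_eq_iff)
  then have *: "?comm (cls [(s, e)]) (cls [(t, True)])"
    using A.commute_inv[of "cls [(s, True)]" "cls [(t, True)]"] by (cases e) (simp_all add: inv_cls_letter)
  then show ?thesis
    using A.commute_inv[of "cls [(t, True)]" "cls [(s, e)]"] by (cases f) (simp_all add: inv_cls_letter)
qed

lemma cls_letter_word_commute:
  assumes "fst x \<in> V" "a \<in> words V" "\<And>c. c \<in> set a \<Longrightarrow> {fst c, fst x} \<in> E"
  shows "cls (a @ [x]) = cls (x # a)"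
  using assms(2,3)
proof (induction a)
  case (Cons c a)
  have "cls ((c # a) @ [x]) = cls [c] \<otimes>\<^bsub>raag V E\<^esub> cls (a @ [x])"
    using Cons.prems assms(1) by (simp add: cls_mult)
  also have "\<dots> = cls [c] \<otimes>\<^bsub>raag V E\<^esub> (cls [x] \<otimes>\<^bsub>raag V E\<^esub> cls a)"
    using Cons assms(1) by (simp add: cls_mult)
  also have "\<dots> = (cls [x] \<otimes>\<^bsub>raag V E\<^esub> cls [c]) \<otimes>\<^bsub>raag V E\<^esub> cls a"
    using Cons.prems assms(1) cls_letter_commute[of "fst c" "fst x" "snd c" "snd x"]
    by (simp add: A.m_assoc[symmetric])
  also have "\<dots> = cls (x # c # a)"
    using Cons.prems assms(1) by (simp add: cls_mult)
  finally show ?case .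
qed simp

lemma trace_eq_imp_cls_eq:
  assumes "u \<sim> v" "u \<in> words V" "v \<in> words V"
  shows "cls u = cls v" "length u = length v"
proof -
  have "cls u = cls v \<and> length u = length v"
    using assms
  proof (induction u arbitrary: v)
    case Nil
    then show ?case using trace_eq_set[of "[]" v] by simp
  next
    case (Cons x u)
    obtain a b where v: "v = a @ x # b"
      and comm: "\<And>c. c \<in> set a \<Longrightarrow> {fst c, fst x} \<in> E" and u: "u \<sim> a @ b"
      using Cons.prems(1) by (rule trace_eq_Cons_split) blast
    have ab: "fst x \<in> V" "a \<in> words V" "b \<in> words V" "u \<in> words V"
      using Cons.prems(2,3) by (auto simp: v)
    have IH: "cls u = cls (a @ b)" "length u = length (a @ b)" using Cons.IH[OF u] ab by auto
    have "cls (x # u) = cls [x] \<otimes>\<^bsub>raag V E\<^esub> cls (a @ b)"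
      using ab by (simp add: cls_mult flip: IH(1))
    also have "\<dots> = cls (x # a) \<otimes>\<^bsub>raag V E\<^esub> cls b"
      using ab by (simp add: cls_mult)
    also have "\<dots> = cls v"
      using ab by (simp add: cls_mult v flip: cls_letter_word_commute[OF ab(1,2) comm])
    finally show ?case using IH(2) by (simp add: v)
  qed
  then show "cls u = cls v" "length u = length v" by auto
qed

definition shortest :: "'a word \<Rightarrow> bool" where
  "shortest w \<longleftrightarrow> w \<in> words V \<and> (\<forall>u\<in>words V. cls u = cls w \<longrightarrow> length w \<le> length u)"

lemma shortest_representative:
  assumes "g \<in> carrier (raag V E)"
  obtains w where "shortest w" "g = cls w"
proof -
  obtain u where u: "u \<in> words V \<and> cls u = g" using assms by (auto simp: carrier_raag)
  from ex_has_least_nat[of "\<lambda>w. w \<in> words V \<and> cls w = g", OF this, of length]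
  obtain w where w: "w \<in> words V" "cls w = g" "\<And>u. u \<in> words V \<Longrightarrow> cls u = g \<Longrightarrow> length w \<le> length u"
    by blast
  have "shortest w" unfolding shortest_def using w by blast
  then show thesis using w(2)[symmetric] by (rule that)
qed

lemma shortest_reduced:
  assumes "shortest w" shows "reduced w"
  unfolding reduced_def
proof
  assume "\<exists>a x b. w \<sim> a @ [x, inv_letter x] @ b"
  then obtain a x b where eq: "w \<sim> a @ [x, inv_letter x] @ b" by blast
  have w: "w \<in> words V" using assms by (simp add: shortest_def)
  then have "set w \<subseteq> V \<times> UNIV" by (auto simp: words_def)
  then have "a @ [x, inv_letter x] @ b \<in> words V" using trace_eq_set[OF eq] by (auto simp: words_def)
  then have ab: "fst x \<in> V" "a \<in> words V" "b \<in> words V" by auto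
  have "[x, inv_letter x] \<doteq> []"
    using word_cong.cancel[OF ab(1), of "snd x"] by (simp add: inv_letter_def)
  then have "cls [x, inv_letter x] = cls []"
    using ab by (simp add: cls_eq_iff)
  then have "cls (a @ b) = cls a \<otimes>\<^bsub>raag V E\<^esub> (cls [x, inv_letter x] \<otimes>\<^bsub>raag V E\<^esub> cls b)"
    using ab by (simp add: cls_mult)
  also have "\<dots> = cls w"
    using ab w trace_eq_imp_cls_eq(1)[OF eq] by (simp add: cls_mult)
  finally have "length w \<le> length (a @ b)"
    using assms ab by (auto simp: shortest_def)
  then show False
    using trace_eq_imp_cls_eq(2)[OF eq] ab w by simp
qed

lemma reduced_cls_eq_imp_trace_eq:
  assumes "reduced u" "reduced v" "u \<in> words V" "v \<in> words V" "cls u = cls v"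
  shows "u \<sim> v"
  using assms reduced_wcong_imp_trace_eq by (simp add: cls_eq_iff)

section \<open>The center\<close>

text \<open>Rotating a word is conjugation, which fixes a central element.\<close>
lemma center_rotate:
  assumes "cls (p @ q) \<in> group_center (raag V E)" "p \<in> words V" "q \<in> words V"
  shows "cls (q @ p) = cls (p @ q)"
proof -
  have "cls p \<otimes>\<^bsub>raag V E\<^esub> cls (q @ p) = cls (p @ q) \<otimes>\<^bsub>raag V E\<^esub> cls p"
    using assms(2,3) by (simp add: cls_mult)
  also have "\<dots> = cls p \<otimes>\<^bsub>raag V E\<^esub> cls (p @ q)"
    using assms by (simp add: group_center_def)
  finally show ?thesis
    using assms(2,3) by (simp only: A.Units_l_cancel A.Units_eq cls_closed words_append)
qed

text \<open>A cancelling pair cannot involve the generator of \<open>x\<close>, which occurs only once; deleting \<open>x\<close>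
  leaves a rearrangement of \<open>a @ b\<close> with the same pair.\<close>
lemma reduced_insert_letter:
  assumes w: "reduced (a @ b)" and x: "fst x \<notin> fst ` set (a @ b)"
  shows "reduced (a @ x # b)"
  unfolding reduced_def
proof
  assume "\<exists>p y q. a @ x # b \<sim> p @ [y, inv_letter y] @ q"
  then obtain p y q where eq: "a @ x # b \<sim> p @ [y, inv_letter y] @ q" by blast
  let ?P = "\<lambda>c. fst c \<noteq> fst x"
  have "\<forall>c\<in>set (a @ b). ?P c" using x by (metis image_eqI)
  then have ab: "filter ?P a = a" "filter ?P b = b" by (simp_all add: filter_id_conv)
  have "fst y \<noteq> fst x"
  proof
    assume "fst y = fst x"
    moreover have "y \<in> set (a @ x # b)" "inv_letter y \<in> set (a @ x # b)"
      using trace_eq_set[OF eq] by auto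
    ultimately have "y = x" "inv_letter y = x"
      using x image_eqI[of _ fst y] image_eqI[of _ fst "inv_letter y"] by auto
    then show False by auto
  qed
  then have "a @ b \<sim> filter ?P p @ [y, inv_letter y] @ filter ?P q"
    using trace_eq_filter[OF eq, of ?P] by (simp add: ab)
  then show False using w unfolding reduced_def by blast
qed

text \<open>Suppose that \<open>u\<close> is not adjacent to the generator of \<open>x\<close>, and project to these two generators.
  All rotations of \<open>w\<close> represent the same element and have the same length, so they are reduced and
  equivalent to \<open>w\<close>. Every letter of the projection of \<open>w\<close> can be rotated to the front, so
  all letters of the projection are equal; since \<open>x\<close> is one of them, \<open>u\<close> does not occur in \<open>w\<close>.
  Then \<open>u w\<close> and \<open>w u\<close> are reduced words for the same element whose projections begin with
  different letters.\<close>
lemma center_support: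
  assumes w: "shortest w" and z: "cls w \<in> group_center (raag V E)"
    and x: "x \<in> set w" and u: "u \<in> V" "u \<noteq> fst x"
  shows "{u, fst x} \<in> E"
proof (rule ccontr)
  assume nonadj: "{u, fst x} \<notin> E"
  let ?P = "\<lambda>c. fst c \<in> {u, fst x}"
  have wV: "w \<in> words V" using w by (simp add: shortest_def)
  have rotate: "c # q @ p \<sim> w" if pq: "w = p @ c # q" for c p q
  proof -
    have V: "p \<in> words V" "c # q \<in> words V" using wV pq by auto
    have eq: "cls (c # q @ p) = cls w"
      using center_rotate[of p "c # q"] z V pq by simp
    then have "shortest (c # q @ p)"
      using w V pq by (auto simp: shortest_def)
    then show ?thesis
      using eq w V wV by (intro reduced_cls_eq_imp_trace_eq shortest_reduced) auto
  qed
  have heads: "hd (filter ?P w) = c" if c: "c \<in> set w" "?P c" for c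
  proof -
    obtain p q where "w = p @ c # q" using split_list[OF c(1)] by blast
    then have "c # q @ p \<sim> w" by (rule rotate)
    from trace_eqD[OF this nonadj] have "filter ?P w = c # filter ?P (q @ p)" using c(2) by simp
    then show ?thesis by simp
  qed
  \<comment> \<open>An occurrence of \<open>u\<close> would be a second possible head, besides \<open>x\<close>.\<close>
  have u_notin: "u \<notin> fst ` set w"
  proof
    assume "u \<in> fst ` set w"
    then obtain c where "c \<in> set w" "fst c = u" by auto
    then show False using heads[of c] heads[of x] x u(2) by auto
  qed
  let ?u = "(u, True)"
  have "cls (?u # w) = cls (w @ [?u])"
    using z u(1) wV cls_mult[of "[?u]" w] cls_mult[of w "[?u]"] by (auto simp: group_center_def)
  moreover have "reduced ([] @ ?u # w)" "reduced (w @ ?u # [])"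
    using u_notin shortest_reduced[OF w] by (intro reduced_insert_letter; simp)+
  ultimately have "?u # w \<sim> w @ [?u]"
    using u(1) wV by (intro reduced_cls_eq_imp_trace_eq) auto
  from trace_eqD[OF this nonadj] have "?u # filter ?P w = filter ?P w @ [?u]" by simp
  moreover have "filter ?P w \<noteq> []" using x by (auto simp: filter_empty_conv)
  ultimately have "?u \<in> set (filter ?P w)"
    by (cases "filter ?P w") auto
  then show False using u_notin by force
qed

section \<open>Sign changes and transvections\<close>

lemma raag_endomorphism:
  assumes f: "f \<in> V \<rightarrow> carrier (raag V E)"
    and comm: "\<And>s t. {s, t} \<in> E \<Longrightarrow> f s \<otimes>\<^bsub>raag V E\<^esub> f t = f t \<otimes>\<^bsub>raag V E\<^esub> f s"
  shows "\<exists>h. h \<in> hom (raag V E) (raag V E) \<and> h \<in> extensional (carrier (raag V E)) \<and>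
    (\<forall>w\<in>words V. h (cls w) = word_eval (raag V E) f w)"
proof -
  have "word_eval (raag V E) f u = word_eval (raag V E) f v"
    if "(u, v) \<in> rels" "u \<in> words V" "v \<in> words V" for u v
    using that comm f by (fastforce simp: Pi_iff)
  then show ?thesis
    by (rule A.presented_group_lift[where R = rels, OF f, folded raag_def]) blast+
qed

text \<open>The action on letters of the automorphism that inverts the generator \<open>s\<close>. It maps reduced words
  to reduced words, so that its effect on elements can be read off from reduced words.\<close>
definition flip :: "'a \<Rightarrow> 'a \<times> bool \<Rightarrow> 'a \<times> bool" where
  "flip s x = (fst x, if fst x = s then \<not> snd x else snd x)"

lemma flip_simps [simp]: "fst (flip s x) = fst x" "flip s (flip s x) = x"
  by (auto simp: flip_def prod_eq_iff)

lemma flip_inv_letter: "flip s (inv_letter x) = inv_letter (flip s x)"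
  by (simp add: flip_def inv_letter_def)

lemma map_flip_words [simp]: "map (flip s) w \<in> words V \<longleftrightarrow> w \<in> words V"
  by (induction w) auto

lemma reduced_map_flip:
  assumes "reduced w" shows "reduced (map (flip s) w)"
  unfolding reduced_def
proof
  assume "\<exists>a x b. map (flip s) w \<sim> a @ [x, inv_letter x] @ b"
  then obtain a x b where "map (flip s) w \<sim> a @ [x, inv_letter x] @ b" by blast
  from trace_eq_map[OF this, of "flip s"]
  have "w \<sim> map (flip s) a @ [flip s x, inv_letter (flip s x)] @ map (flip s) b"
    by (simp add: o_def flip_inv_letter)
  then show False using assms unfolding reduced_def by blast
qed

lemma flip_automorphism:
  obtains h where "h \<in> auto (raag V E)" "\<And>w. w \<in> words V \<Longrightarrow> h (cls w) = cls (map (flip s) w)"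
proof -
  let ?f = "\<lambda>t. cls [flip s (t, True)]"
  have "?f \<in> V \<rightarrow> carrier (raag V E)" by auto
  moreover have "?f t \<otimes>\<^bsub>raag V E\<^esub> ?f u = ?f u \<otimes>\<^bsub>raag V E\<^esub> ?f t" if "{t, u} \<in> E" for t u
    using cls_letter_commute[OF that] by (simp add: flip_def)
  ultimately have "\<exists>h. h \<in> hom (raag V E) (raag V E) \<and> h \<in> extensional (carrier (raag V E)) \<and>
      (\<forall>w\<in>words V. h (cls w) = word_eval (raag V E) ?f w)"
    by (rule raag_endomorphism)
  then obtain h where hom: "h \<in> hom (raag V E) (raag V E)"
    and ext: "h \<in> extensional (carrier (raag V E))"
    and h: "\<And>w. w \<in> words V \<Longrightarrow> h (cls w) = word_eval (raag V E) ?f w"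
    by blast
  have flip: "h (cls w) = cls (map (flip s) w)" if "w \<in> words V" for w
  proof -
    have "word_eval (raag V E) ?f w = cls (map (flip s) w)"
      using that
    proof (induction w)
      case (Cons x w)
      obtain t e where x: "x = (t, e)" by force
      have "(if e then ?f t else inv\<^bsub>raag V E\<^esub> ?f t) = cls [flip s x]"
        using Cons.prems inv_cls_letter[of t] by (simp add: x flip_def)
      then have "word_eval (raag V E) ?f (x # w) = cls [flip s x] \<otimes>\<^bsub>raag V E\<^esub> cls (map (flip s) w)"
        using Cons by (simp add: x)
      then show ?case using Cons.prems by (simp add: cls_mult)
    qed (simp add: cls_Nil)
    then show ?thesis using h that by simp
  qed
  have "h (h g) = g" if "g \<in> carrier (raag V E)" for g
    using that by (auto simp: carrier_raag flip o_def)
  then have "h \<in> auto (raag V E)" using hom ext by (intro autoI[where k = h]) auto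
  then show thesis using flip by (rule that)
qed

lemma raag_hom_eqI:
  assumes "h \<in> hom (raag V E) (raag V E)" "k \<in> hom (raag V E) (raag V E)"
    and "\<And>s. s \<in> V \<Longrightarrow> h (cls [(s, True)]) = k (cls [(s, True)])" "g \<in> carrier (raag V E)"
  shows "h g = k g"
  using assms hom_presented_group_eqI[OF group_raag, where V1 = V and E1 = E and S = V and R = rels]
  unfolding raag_def by blast

lemma transvection_automorphism:
  assumes c: "c \<in> V" "\<And>t. t \<in> V \<Longrightarrow> t \<noteq> c \<Longrightarrow> {t, c} \<in> E" and u: "u \<in> V" "u \<noteq> c"
  obtains h where "h \<in> auto (raag V E)" "h (cls [(u, True)]) = cls [(u, True), (c, True)]"
proof -
  \<comment> \<open>The sign \<open>e\<close> treats \<open>u \<mapsto> u c\<close> together with its inverse \<open>u \<mapsto> u c\<^sup>-\<^sup>1\<close>.\<close>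
  let ?f = "\<lambda>e t. if t = u then cls [(u, True), (c, e)] else cls [(t, True)]"
  let ?comm = "\<lambda>g h. g \<otimes>\<^bsub>raag V E\<^esub> h = h \<otimes>\<^bsub>raag V E\<^esub> g"
  have comm_u: "?comm (?f e u) (?f e t)" if t: "{u, t} \<in> E" for e t
  proof -
    have tV: "t \<in> V" "t \<noteq> u" using edge_in_V[OF t] t by auto
    have "cls [(c, e), (t, True)] = cls [(t, True), (c, e)]"
    proof (cases "t = c")
      case True
      have "inv\<^bsub>raag V E\<^esub> cls [(c, True)] \<otimes>\<^bsub>raag V E\<^esub> cls [(c, True)] = cls [(c, True)] \<otimes>\<^bsub>raag V E\<^esub> inv\<^bsub>raag V E\<^esub> cls [(c, True)]"
        using c(1) by simp
      then show ?thesis using c(1) True by (cases e) (simp_all add: inv_cls_letter cls_mult)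
    next
      case False
      then show ?thesis using cls_letter_commute[OF c(2)[OF tV(1) False], of True e] c(1) tV(1)
        by (simp add: cls_mult)
    qed
    then have "cls [(u, True)] \<otimes>\<^bsub>raag V E\<^esub> cls [(c, e), (t, True)]
        = cls [(u, True), (t, True)] \<otimes>\<^bsub>raag V E\<^esub> cls [(c, e)]"
      using u c(1) tV by (simp add: cls_mult)
    also have "cls [(u, True), (t, True)] = cls [(t, True), (u, True)]"
      using cls_letter_commute[OF t, of True True] u tV by (simp add: cls_mult)
    finally show ?thesis using u c(1) tV by (simp add: cls_mult)
  qed
  have f: "?f e \<in> V \<rightarrow> carrier (raag V E)" for e using u c by auto
  have comm: "?comm (?f e s) (?f e t)" if st: "{s, t} \<in> E" for e s t
  proof -
    consider "s = u" | "t = u" | "s \<noteq> u" "t \<noteq> u" by blast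
    then show ?thesis
    proof cases
      case 1
      then show ?thesis using comm_u st by blast
    next
      case 2
      then show ?thesis using comm_u[of s e] st by (simp add: insert_commute)
    next
      case 3
      then show ?thesis using cls_letter_commute[OF st] by simp
    qed
  qed
  have "\<exists>h. h \<in> hom (raag V E) (raag V E) \<and> h \<in> extensional (carrier (raag V E)) \<and>
      (\<forall>s\<in>V. h (cls [(s, True)]) = ?f e s)" for e
  proof -
    obtain h where "h \<in> hom (raag V E) (raag V E)" "h \<in> extensional (carrier (raag V E))"
      and "\<forall>w\<in>words V. h (cls w) = word_eval (raag V E) (?f e) w"
      using raag_endomorphism[OF f comm, of e] by blast
    then show ?thesis using f[of e] by (intro exI[of _ h]) (auto simp: Pi_iff)
  qed
  then have "\<exists>h. \<forall>e. h e \<in> hom (raag V E) (raag V E) \<and>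
      h e \<in> extensional (carrier (raag V E)) \<and> (\<forall>s\<in>V. h e (cls [(s, True)]) = ?f e s)"
    by (intro choice allI)
  then obtain h where hom: "\<And>e. h e \<in> hom (raag V E) (raag V E)"
    and ext: "\<And>e. h e \<in> extensional (carrier (raag V E))"
    and h: "\<And>e s. s \<in> V \<Longrightarrow> h e (cls [(s, True)]) = ?f e s"
    by blast
  have hc: "h e (cls [(c, d)]) = cls [(c, d)]" for e d
  proof -
    interpret h: group_hom "raag V E" "raag V E" "h e"
      using hom by (simp add: group_hom_def group_hom_axioms_def A.is_group)
    have "h e (cls [(c, True)]) = cls [(c, True)]" using h c u by simp
    then show ?thesis
      using h.hom_inv[of "cls [(c, True)]"] c(1) by (cases d) (simp_all add: inv_cls_letter)
  qed
  have inverse: "h (\<not> e) (h e g) = g" if "g \<in> carrier (raag V E)" for e g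
  proof -
    have "(h (\<not> e) \<circ> h e) g = id g"
    proof (rule raag_hom_eqI[OF _ _ _ that])
      show "h (\<not> e) \<circ> h e \<in> hom (raag V E) (raag V E)" using hom[of e] hom by (rule hom_compose)
      show "id \<in> hom (raag V E) (raag V E)" by (auto intro: homI)
      fix s assume s: "s \<in> V"
      show "(h (\<not> e) \<circ> h e) (cls [(s, True)]) = id (cls [(s, True)])"
      proof (cases "s = u")
        case True
        have "h (\<not> e) (cls [(u, True), (c, e)])
            = h (\<not> e) (cls [(u, True)]) \<otimes>\<^bsub>raag V E\<^esub> h (\<not> e) (cls [(c, e)])"
          using hom_mult[OF hom, of "cls [(u, True)]" "cls [(c, e)]"] u c by (simp add: cls_mult)
        also have "\<dots> = cls [(u, True)] \<otimes>\<^bsub>raag V E\<^esub> (cls [(c, \<not> e)] \<otimes>\<^bsub>raag V E\<^esub> cls [(c, e)])"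
          using u c by (simp add: h hc cls_mult)
        also have "\<dots> = cls [(u, True)]"
          using u c(1) by (simp flip: inv_cls_letter)
        finally show ?thesis using True h u by simp
      qed (use h s in simp)
    qed
    then show ?thesis by simp
  qed
  have "h True \<in> auto (raag V E)"
    using hom ext inverse[of _ True] inverse[of _ False] by (intro autoI[where k = "h False"]) auto
  moreover have "h True (cls [(u, True)]) = cls [(u, True), (c, True)]" using h[OF u(1)] by simp
  ultimately show thesis by (rule that)
qed

section \<open>The center of the automorphism group\<close>

text \<open>A letter of a shortest word for the central element \<open>v\<^sup>-\<^sup>1 \<phi>(v)\<close> is excluded by \<open>center_support\<close>
  if its generator is \<open>v\<close>, and otherwise by the automorphism that inverts its generator.\<close>
lemma central_auto_fixes_non_cone:
  assumes \<phi>: "\<phi> \<in> group_center (AutoGroup (raag V E))"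
    and v: "v \<in> V" and u: "u \<in> V" "u \<noteq> v" "{u, v} \<notin> E"
  shows "\<phi> (cls [(v, True)]) = cls [(v, True)]"
proof -
  let ?v = "cls [(v, True)]"
  have auto: "\<phi> \<in> auto (raag V E)" using \<phi> by (auto simp: group_center_def carrier_AutoGroup)
  note \<phi>_simps = A.autoD(4-6)[OF auto]
  have vA: "?v \<in> carrier (raag V E)" using v by simp
  define z where "z = inv\<^bsub>raag V E\<^esub> ?v \<otimes>\<^bsub>raag V E\<^esub> \<phi> ?v"
  have z: "z \<in> group_center (raag V E)"
    unfolding z_def by (rule A.central_auto_displacement[OF \<phi> vA])
  then have zA: "z \<in> carrier (raag V E)" by (simp add: group_center_def)
  obtain w where w: "shortest w" "z = cls w" using shortest_representative[OF zA] .
  have wV: "w \<in> words V" using w(1) by (simp add: shortest_def)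
  have False if x: "x \<in> set w" for x
  proof (cases "fst x = v")
    case True
    then show False using center_support[OF w(1) _ x u(1)] z w(2) u by simp
  next
    case False
    obtain h where h: "h \<in> auto (raag V E)"
      and flip: "\<And>w. w \<in> words V \<Longrightarrow> h (cls w) = cls (map (flip (fst x)) w)"
      using flip_automorphism[of "fst x"] by blast
    have hv: "h ?v = ?v" using flip[of "[(v, True)]"] v False by (simp add: flip_def)
    have "h z = inv\<^bsub>raag V E\<^esub> (h ?v) \<otimes>\<^bsub>raag V E\<^esub> h (\<phi> ?v)"
      using vA by (simp add: z_def A.autoD[OF h] \<phi>_simps)
    also have "h (\<phi> ?v) = \<phi> ?v"
      using center_AutoGroupD[OF \<phi> h vA] hv by simp
    finally have "cls (map (flip (fst x)) w) = cls w"
      using flip[OF wV] w(2) hv by (simp add: z_def)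
    then have "map (flip (fst x)) w \<sim> w"
      using wV shortest_reduced[OF w(1)]
      by (intro reduced_cls_eq_imp_trace_eq reduced_map_flip) auto
    from trace_eqD[OF this, of "fst x" "fst x"]
    have "map (flip (fst x)) (filter (\<lambda>y. fst y = fst x) w) = filter (\<lambda>y. fst y = fst x) w"
      by (simp add: filter_map o_def)
    then have "\<forall>y\<in>set (filter (\<lambda>y. fst y = fst x) w). flip (fst x) y = y"
      by (metis list.map_ident map_eq_conv)
    then have "flip (fst x) x = x" by (rule bspec) (use x in simp)
    then show False by (simp add: flip_def prod_eq_iff)
  qed
  then have "w = []" by (cases w) auto
  then have z1: "z = \<one>\<^bsub>raag V E\<^esub>" using w(2) cls_Nil by simp
  have "\<phi> ?v = ?v \<otimes>\<^bsub>raag V E\<^esub> z"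
    unfolding z_def by (rule A.inv_mult_cancel(2)[OF vA \<phi>_simps(1)[OF vA], symmetric])
  then show ?thesis using vA by (simp add: z1)
qed

lemma central_auto_trivial:
  assumes nc: "\<not> is_clique V E" and \<phi>: "\<phi> \<in> group_center (AutoGroup (raag V E))"
  shows "\<phi> = (\<lambda>g\<in>carrier (raag V E). g)"
proof -
  have auto: "\<phi> \<in> auto (raag V E)" using \<phi> by (auto simp: group_center_def carrier_AutoGroup)
  note \<phi>_simps = A.autoD(4-6)[OF auto]
  obtain u v where uv: "u \<in> V" "v \<in> V" "v \<noteq> u" "{v, u} \<notin> E"
    using nc by (auto simp: is_clique_def insert_commute)
  have \<phi>u: "\<phi> (cls [(u, True)]) = cls [(u, True)]"
    using central_auto_fixes_non_cone[OF \<phi> uv(1,2,3,4)] .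
  have gens: "\<phi> (cls [(c, True)]) = cls [(c, True)]" if c: "c \<in> V" for c
  proof (cases "\<exists>t\<in>V. t \<noteq> c \<and> {t, c} \<notin> E")
    case True
    then show ?thesis using central_auto_fixes_non_cone[OF \<phi> c] by blast
  next
    case False
    then have "u \<noteq> c" using uv by blast
    then obtain h where h: "h \<in> auto (raag V E)" "h (cls [(u, True)]) = cls [(u, True), (c, True)]"
      using transvection_automorphism[OF c _ uv(1)] False by blast
    have eq: "cls [(u, True), (c, True)] = cls [(u, True)] \<otimes>\<^bsub>raag V E\<^esub> cls [(c, True)]"
      using uv c by (simp add: cls_mult)
    have "\<phi> (cls [(u, True), (c, True)]) = cls [(u, True), (c, True)]"
      using center_AutoGroupD[OF \<phi> h(1), of "cls [(u, True)]"] uv \<phi>u h(2) by simp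
    then show ?thesis using uv c \<phi>_simps \<phi>u unfolding eq by simp
  qed
  have "\<phi> g = g" if "g \<in> carrier (raag V E)" for g
  proof -
    have "id \<in> hom (raag V E) (raag V E)" by (auto intro: homI)
    from raag_hom_eqI[OF A.autoD(1)[OF auto] this _ that] show ?thesis using gens by simp
  qed
  then show ?thesis
    by (intro extensionalityI[OF A.autoD(3)[OF auto] restrict_extensional]) simp
qed

lemma clique_raag_comm_group:
  assumes "is_clique V E" shows "comm_group (raag V E)"
proof -
  have letter: "cls [x] \<otimes>\<^bsub>raag V E\<^esub> cls [y] = cls [y] \<otimes>\<^bsub>raag V E\<^esub> cls [x]"
    if xy: "fst x \<in> V" "fst y \<in> V" for x y
  proof (cases "fst x = fst y")
    case True
    then consider "x = y" | "y = (fst x, \<not> snd x)" by (cases x; cases y) auto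
    then show ?thesis
    proof cases
      case 2
      have "cls [y] = inv\<^bsub>raag V E\<^esub> cls [x]" using inv_cls_letter[of "fst x" "snd x"] xy 2 by simp
      then show ?thesis using xy by simp
    qed simp
  next
    case False
    then have "{fst x, fst y} \<in> E" using assms xy by (auto simp: is_clique_def)
    from cls_letter_commute[OF this, of "snd x" "snd y"] show ?thesis by simp
  qed
  have letter_word: "cls [x] \<otimes>\<^bsub>raag V E\<^esub> cls w = cls w \<otimes>\<^bsub>raag V E\<^esub> cls [x]"
    if "fst x \<in> V" "w \<in> words V" for x w
    using that(2)
  proof (induction w)
    case (Cons y w)
    then have yw: "cls (y # w) = cls [y] \<otimes>\<^bsub>raag V E\<^esub> cls w" by (simp add: cls_mult)
    show ?case
      using Cons that(1) letter[of x y] unfolding yw by (intro A.commute_mult) auto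
  qed (use that in \<open>simp add: cls_Nil\<close>)
  have "cls u \<otimes>\<^bsub>raag V E\<^esub> cls w = cls w \<otimes>\<^bsub>raag V E\<^esub> cls u" if "u \<in> words V" "w \<in> words V" for u w
    using that
  proof (induction u)
    case (Cons x u)
    then have xu: "cls (x # u) = cls [x] \<otimes>\<^bsub>raag V E\<^esub> cls u" by (simp add: cls_mult)
    show ?case
      using Cons letter_word[of x w] A.commute_mult[of "cls w" "cls [x]" "cls u"] unfolding xu by simp
  qed (simp add: cls_Nil)
  then show ?thesis by (intro A.group_comm_groupI) (auto simp: carrier_raag)
qed

lemma inv_generator_neq:
  assumes v: "v \<in> V"
  shows "inv\<^bsub>raag V E\<^esub> cls [(v, True)] \<noteq> cls [(v, True)]"
proof
  assume "inv\<^bsub>raag V E\<^esub> cls [(v, True)] = cls [(v, True)]"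
  then have "cls [(v, False)] = cls [(v, True)]" using inv_cls_letter[OF v, of True] by simp
  moreover have "reduced [(v, e)]" for e using reduced_insert_letter[of "[]" "[]"] by simp
  ultimately have "[(v, False)] \<sim> [(v, True)]"
    using v by (intro reduced_cls_eq_imp_trace_eq) auto
  from trace_eq_set[OF this] show False by simp
qed

end

theorem corollaryD:
  fixes V :: "'a set" and E :: "'a set set"
  assumes "finite V" and "E \<subseteq> [V]\<^bsup>2\<^esup>" and "V \<noteq> {}"
  shows "centerless (AutoGroup (raag V E)) \<longleftrightarrow> \<not> is_clique V E"
proof -
  interpret raag_graph V E by unfold_locales (fact assms(2))
  interpret Aut: group "AutoGroup (raag V E)" by (rule A.AutoGroup)
  show ?thesis
  proof (cases "is_clique V E")
    case True
    obtain v where "v \<in> V" using assms(3) by blast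
    then show ?thesis
      using comm_group.AutoGroup_not_centerless[OF clique_raag_comm_group[OF True], of "cls [(v, True)]"]
        inv_generator_neq True by simp
  next
    case False
    have "\<one>\<^bsub>AutoGroup (raag V E)\<^esub> \<in> group_center (AutoGroup (raag V E))"
      by (simp add: group_center_def)
    moreover have "\<phi> = \<one>\<^bsub>AutoGroup (raag V E)\<^esub>" if "\<phi> \<in> group_center (AutoGroup (raag V E))" for \<phi>
      using central_auto_trivial[OF False that] by (simp only: one_AutoGroup)
    ultimately have "group_center (AutoGroup (raag V E)) = {\<one>\<^bsub>AutoGroup (raag V E)\<^esub>}" by blast
    then show ?thesis using False by (simp add: centerless_def)
  qed
qed

end
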